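(* Let $s\in\mathbb{N}$, $l_1,\ldots,l_s\in\mathbb{N}$ and let $k_1<k_2$ be arbitrary real numbers. Let $f_1:\mathbb{Q}^{l_1}\rightarrow X_1,\ldots,f_s:\mathbb{Q}^{l_s}\rightarrow X_s$ be arbitrary functions with values in compact metric spaces $X_1,\ldots,X_s$ respectively. For any $\varepsilon>0$, $k\in\mathbb{N}$ and non-empty finite sets $F_1\subseteq\mathbb{Q}^{l_1},\ldots,F_s\subseteq\mathbb{Q}^{l_s}$ there exist $\alpha_i\in\mathbb{Q}^{l_i}$ for $1\leq i\leq s$, $\beta\in\mathbb{Q}\setminus\mathbb{Z}$ and $\gamma\in\mathbb{Z}^\ast$ with $dom^+(\beta)=\emptyset=dom^-(\gamma)$ and $\max dom^-(\beta)<k_1<k_2<\min dom^+(\gamma)$ such that $diam\big(f_i(\alpha_i+(p\beta+q\gamma)F_i)\big)<\varepsilon$ for all integers $0\leq p,q\leq k$ and all $1\leq i\leq s$.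
   Context: Notation: $\mathbb{N}=\{1,2,\ldots\}$, $\mathbb{Z}^\ast=\mathbb{Z}\setminus\{0\}$; for $\alpha\in\mathbb{Q}^l$, $c\in\mathbb{Q}$ and $F\subseteq\mathbb{Q}^l$, $\alpha+cF=\{\alpha+cf: f\in F\}$; $diam(A)=\sup\{d(x,y): x,y\in A\}$, where $d$ is the relevant metric. Expansion of rationals: every rational number $q$ has a unique expression $q=\sum_{s=1}^{\infty}q_{-s}\frac{(-1)^{s}}{(s+1)!}+\sum_{r=1}^{\infty}q_{r}(-1)^{r+1}r!$ with integers $0\leq q_{-s}\leq s$ for $s\geq 1$ and $0\leq q_r\leq r$ for $r\geq 1$, all but finitely many of which are zero. Put $dom(q)=\{t\in\mathbb{Z}^\ast: q_t\neq 0\}$, $dom^-(q)=\{t\in dom(q): t<0\}$, $dom^+(q)=\{t\in dom(q): t>0\}$. *)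

theory Defs
  imports "HOL-Analysis.Analysis"
begin

(* Points of Q^l are functions nat => rat vanishing outside the index set {1..l}, so that
   the pointwise operations below do not leave Q^l and equality is equality of functions. *)
definition rat_space :: "nat \<Rightarrow> (nat \<Rightarrow> rat) set" where
  "rat_space l = {x. \<forall>j. j \<notin> {1..l} \<longrightarrow> x j = 0}"

definition translate_scale :: "(nat \<Rightarrow> rat) \<Rightarrow> rat \<Rightarrow> (nat \<Rightarrow> rat) set \<Rightarrow> (nat \<Rightarrow> rat) set" where
  "translate_scale \<alpha> c F = (\<lambda>x j. \<alpha> j + c * x j) ` F"

(* Used only for nonempty bounded sets: Sup of the empty or of an unbounded set of reals
   is unspecified. *)
definition mdiam :: "'a metric \<Rightarrow> 'a set \<Rightarrow> real" where
  "mdiam X A = Sup {mdist X x y | x y. x \<in> A \<and> y \<in> A}"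

(* The digits of q are indexed by the nonzero integers; the irrelevant value at 0 is fixed
   to be 0 so that the digit function is uniquely determined. Both series have only
   finitely many nonzero terms and are written as the sums of these terms. *)
definition is_expansion :: "rat \<Rightarrow> (int \<Rightarrow> int) \<Rightarrow> bool" where
  "is_expansion q d \<longleftrightarrow>
     d 0 = 0 \<and>
     (\<forall>s::nat. s \<ge> 1 \<longrightarrow> 0 \<le> d (- int s) \<and> d (- int s) \<le> int s) \<and>
     (\<forall>r::nat. r \<ge> 1 \<longrightarrow> 0 \<le> d (int r) \<and> d (int r) \<le> int r) \<and>
     finite {t. d t \<noteq> 0} \<and>
     q = (\<Sum>s | s \<ge> 1 \<and> d (- int s) \<noteq> 0. of_int (d (- int s)) * ((-1) ^ s / fact (s + 1)))
       + (\<Sum>r | r \<ge> 1 \<and> d (int r) \<noteq> 0. of_int (d (int r)) * ((-1) ^ (r + 1) * fact r))"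

(* Meaningful because every rational has exactly one such expansion: the sums over r run
   bijectively through the integers and the sums over s through Q modulo Z. *)
definition digit :: "rat \<Rightarrow> int \<Rightarrow> int" where
  "digit q = (THE d. is_expansion q d)"

definition rdom :: "rat \<Rightarrow> int set" where
  "rdom q = {t. t \<noteq> 0 \<and> digit q t \<noteq> 0}"

definition rdom_neg :: "rat \<Rightarrow> int set" where
  "rdom_neg q = {t \<in> rdom q. t < 0}"

definition rdom_pos :: "rat \<Rightarrow> int set" where
  "rdom_pos q = {t \<in> rdom q. t > 0}"

end

theory Submission
  imports Defs "HOL-Library.Function_Algebras"
begin

text \<open>
  The statement is a case of an IP version of Gallai's theorem: for a finite family of sequences
  \<open>v a\<close> in an abelian group and a finite colouring \<open>\<kappa>\<close> there are a point \<open>x\<close> and a nonempty finite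
  set \<open>H\<close> beyond any given bound such that \<open>\<kappa> (x + (\<Sum>n\<in>H. v a n))\<close> does not depend on \<open>a\<close>.
  Covering the compact spaces by finitely many small balls turns all the \<open>f i\<close> into a single colouring
  of the product of the spaces of arguments. The letters are the triples of \<open>p\<close>, \<open>q\<close> and a choice of
  one point \<open>\<phi> i\<close> in each \<open>F i\<close>, with \<open>v (p, q, \<phi>) n i = (p b\<^sub>n + q g\<^sub>n) \<phi> i\<close>, where \<open>b\<^sub>n\<close> and
  \<open>g\<^sub>n\<close> are the terms with index \<open>-n\<close> and \<open>n\<close> of the expansion of rationals. The sums of \<open>b\<^sub>n\<close> and \<open>g\<^sub>n\<close>
  over \<open>H\<close> are \<open>\<beta>\<close> and \<open>\<gamma>\<close>; their digits can be read off because expansions are unique.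
\<close>

section \<open>Uniqueness of the expansion of rationals\<close>

text \<open>Multiplying by \<open>fact (Suc M)\<close> clears every denominator except that of the
  last term, which leaves \<open>u (Suc M) / (M + 2)\<close> up to sign. So \<open>M + 2\<close>
  divides a number of absolute value at most \<open>M + 1\<close>, the last term vanishes, and the
  induction continues downwards. Signed \<open>u\<close> are allowed because they will be
  differences of digits, and integrality is assumed instead of zero in order to absorb the integer
  part.\<close>

lemma neg_digits_zero:
  fixes u :: "nat \<Rightarrow> int"
  assumes "\<And>s. s \<ge> 1 \<Longrightarrow> \<bar>u s\<bar> \<le> int s"
    and "(\<Sum>s=1..M. of_int (u s) * ((-1) ^ s / fact (s + 1)) :: rat) \<in> \<int>"
  shows "\<forall>s\<in>{1..M}. u s = 0"
  using assms(2)
proof (induction M)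
  case (Suc M)
  let ?S = "\<Sum>s=1..M. of_int (u s) * ((-1) ^ s / fact (s + 1)) :: rat"
  let ?t = "of_int (u (Suc M)) * ((-1) ^ Suc M / fact (Suc M + 1)) :: rat"
  have "fact (Suc M) * ?S = (\<Sum>s=1..M. fact (Suc M) * (of_int (u s) * ((-1) ^ s / fact (s + 1))))"
    by (rule sum_distrib_left)
  also have "\<dots> \<in> \<int>"
  proof (rule Ints_sum)
    fix s assume s: "s \<in> {1..M}"
    then have "(fact (s + 1) :: int) dvd fact (Suc M)"
      by (intro fact_dvd) auto
    then obtain w :: int where w: "(fact (Suc M) :: int) = fact (s + 1) * w"
      by (auto elim: dvdE)
    have "(fact (Suc M) :: rat) = of_int (fact (Suc M))" by (simp only: of_int_fact)
    also have "\<dots> = fact (s + 1) * of_int w" by (simp only: w of_int_mult of_int_fact)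
    finally have "fact (Suc M) * (of_int (u s) * ((-1) ^ s / fact (s + 1)))
      = (of_int (w * u s * (-1) ^ s) :: rat)"
      by (simp del: fact_Suc add: field_simps)
    then show "fact (Suc M) * (of_int (u s) * ((-1) ^ s / fact (s + 1))) \<in> (\<int> :: rat set)"
      by (metis Ints_of_int)
  qed
  finally have 1: "fact (Suc M) * ?S \<in> \<int>" .
  have 2: "?S + ?t \<in> \<int>" using Suc.prems by simp
  have "fact (Suc M) * (?S + ?t) - fact (Suc M) * ?S \<in> \<int>"
    by (rule Ints_diff[OF Ints_mult[OF _ 2] 1]) (metis Ints_of_int of_int_fact)
  moreover have "fact (Suc M) * (?S + ?t) - fact (Suc M) * ?S = fact (Suc M) * ?t"
    by (simp only: distrib_left add_diff_cancel_left')
  moreover have "fact (Suc M) * ?t = of_int (u (Suc M) * (-1) ^ Suc M) / of_nat (M + 2)"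
  proof -
    have "(fact (Suc M + 1) :: rat) = of_nat (M + 2) * fact (Suc M)" by simp
    then show ?thesis by (simp del: fact_Suc)
  qed
  ultimately have "of_int (u (Suc M) * (-1) ^ Suc M) / of_nat (M + 2) \<in> (\<int> :: rat set)"
    by (simp only:)
  then obtain w where "of_int (u (Suc M) * (-1) ^ Suc M) / of_nat (M + 2) = (of_int w :: rat)"
    by (rule Ints_cases)
  then have "of_int (u (Suc M) * (-1) ^ Suc M) = (of_int (w * int (M + 2)) :: rat)"
    by (simp add: field_simps)
  then have "u (Suc M) * (-1) ^ Suc M = w * int (M + 2)" by (simp only: of_int_eq_iff)
  then have "int (M + 2) dvd u (Suc M) * (-1) ^ Suc M" by (metis dvd_triv_right)
  then have "int (M + 2) dvd u (Suc M)" by (cases "even M") auto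
  moreover have "\<bar>u (Suc M)\<bar> < int (M + 2)" using assms(1)[of "Suc M"] by simp
  ultimately have z: "u (Suc M) = 0" by (metis abs_of_nat dvd_imp_le_int not_le)
  then have "\<forall>s\<in>{1..M}. u s = 0" using Suc 2 by simp
  then show ?case using z by (simp add: atLeastAtMostSuc_conv)
qed auto

text \<open>Here the digits are peeled off from below: once the smaller ones vanish, all terms
  beyond \<open>r\<close> are divisible by \<open>fact (r + 1)\<close>, hence \<open>r + 1\<close>
  divides \<open>u r\<close>, which is too small unless it is 0.\<close>

lemma pos_digits_zero:
  fixes u :: "nat \<Rightarrow> int"
  assumes bound: "\<And>r. r \<ge> 1 \<Longrightarrow> \<bar>u r\<bar> \<le> int r"
    and zero: "(\<Sum>r=1..M. u r * ((-1) ^ (r + 1) * fact r)) = 0"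
  shows "\<forall>r\<in>{1..M}. u r = 0"
proof -
  have "r \<in> {1..M} \<longrightarrow> u r = 0" for r
  proof (induction r rule: less_induct)
    case (less r)
    show ?case
    proof
      assume r: "r \<in> {1..M}"
      let ?g = "\<lambda>r. u r * ((-1) ^ (r + 1) * fact r)"
      have "(\<Sum>i=1..M. ?g i) = (\<Sum>i\<in>{1..<r}. ?g i) + (?g r + (\<Sum>i\<in>{r<..M}. ?g i))"
      proof -
        have "{1..M} = {1..<r} \<union> insert r {r<..M}" using r by auto
        then show ?thesis by (simp add: sum.union_disjoint Int_def)
      qed
      moreover have "(\<Sum>i\<in>{1..<r}. ?g i) = 0" using less r by (intro sum.neutral) auto
      moreover have "fact (r + 1) dvd (\<Sum>i\<in>{r<..M}. ?g i)"
        by (intro dvd_sum dvd_mult fact_dvd) (simp add: Suc_le_eq)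
      ultimately have "?g r = - (\<Sum>i\<in>{r<..M}. ?g i)" "fact (r + 1) dvd - (\<Sum>i\<in>{r<..M}. ?g i)"
        using zero by (linarith, simp only: dvd_minus_iff)
      then have "fact (r + 1) dvd ?g r" by (simp only:)
      then have "fact r * int (r + 1) dvd fact r * (u r * (-1) ^ (r + 1))"
        by (simp add: algebra_simps)
      then have "int (r + 1) dvd u r * (-1) ^ (r + 1)"
        by (simp only: dvd_mult_cancel_left) auto
      then have "int (r + 1) dvd u r"
        by (cases "even r") auto
      moreover have "\<bar>u r\<bar> < int (r + 1)" using bound[of r] r by simp
      ultimately show "u r = 0" by (metis abs_of_nat dvd_imp_le_int not_le)
    qed
  qed
  then show ?thesis by blast
qed

text \<open>Two expansions have different supports; a common cutoff \<open>M\<close> allows them to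
  be subtracted termwise. The second sum is cast from the integers to show its integrality.\<close>

lemma is_expansion_truncate:
  assumes "is_expansion q d"
  shows "\<exists>M0. \<forall>M\<ge>M0.
    q = (\<Sum>s=1..M. of_int (d (- int s)) * ((-1) ^ s / fact (s + 1)))
      + of_int (\<Sum>r=1..M. d (int r) * ((-1) ^ (r + 1) * fact r))"
proof -
  have fin: "finite {t. d t \<noteq> 0}" using assms by (simp add: is_expansion_def)
  define M0 where "M0 = Max (insert 0 ((nat \<circ> abs) ` {t. d t \<noteq> 0}))"
  have M0: "nat \<bar>t\<bar> \<le> M0" if "d t \<noteq> 0" for t
    unfolding M0_def by (rule Max_ge) (use fin that in auto)
  show ?thesis
  proof (intro exI allI impI)
    fix M assume M: "M \<ge> M0"
    have "(\<Sum>s | s \<ge> 1 \<and> d (- int s) \<noteq> 0. of_int (d (- int s)) * ((-1) ^ s / fact (s + 1)))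
      = (\<Sum>s=1..M. of_int (d (- int s)) * ((-1) ^ s / fact (s + 1)) :: rat)"
    proof (rule sum.mono_neutral_left)
      show "{s. s \<ge> 1 \<and> d (- int s) \<noteq> 0} \<subseteq> {1..M}"
      proof
        fix s assume "s \<in> {s. s \<ge> 1 \<and> d (- int s) \<noteq> 0}"
        then show "s \<in> {1..M}" using M M0[of "- int s"] by simp
      qed
    qed auto
    moreover have "(\<Sum>r | r \<ge> 1 \<and> d (int r) \<noteq> 0. of_int (d (int r)) * ((-1) ^ (r + 1) * fact r))
      = (\<Sum>r=1..M. of_int (d (int r)) * ((-1) ^ (r + 1) * fact r) :: rat)"
    proof (rule sum.mono_neutral_left)
      show "{r. r \<ge> 1 \<and> d (int r) \<noteq> 0} \<subseteq> {1..M}"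
      proof
        fix r assume "r \<in> {r. r \<ge> 1 \<and> d (int r) \<noteq> 0}"
        then show "r \<in> {1..M}" using M M0[of "int r"] by simp
      qed
    qed auto
    moreover have "(\<Sum>r=1..M. of_int (d (int r)) * ((-1) ^ (r + 1) * fact r) :: rat)
      = of_int (\<Sum>r=1..M. d (int r) * ((-1) ^ (r + 1) * fact r))"
      by (simp only: of_int_sum of_int_mult of_int_power of_int_minus of_int_1 of_int_fact)
    ultimately show "q = (\<Sum>s=1..M. of_int (d (- int s)) * ((-1) ^ s / fact (s + 1)))
        + of_int (\<Sum>r=1..M. d (int r) * ((-1) ^ (r + 1) * fact r))"
      using assms unfolding is_expansion_def by (simp only:)
  qed
qed

text \<open>In the difference of two expansions the fractional sum equals an integer, so the digits
  at negative places agree; then the integer sum is 0 and the digits at positive places agree as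
  well.\<close>

lemma is_expansion_unique:
  assumes d: "is_expansion q d" and d': "is_expansion q d'"
  shows "d = d'"
proof
  fix t
  obtain M1 where M1: "\<forall>M\<ge>M1.
      q = (\<Sum>s=1..M. of_int (d (- int s)) * ((-1) ^ s / fact (s + 1)))
        + of_int (\<Sum>r=1..M. d (int r) * ((-1) ^ (r + 1) * fact r))"
    by (rule exE[OF is_expansion_truncate[OF d]])
  obtain M2 where M2: "\<forall>M\<ge>M2.
      q = (\<Sum>s=1..M. of_int (d' (- int s)) * ((-1) ^ s / fact (s + 1)))
        + of_int (\<Sum>r=1..M. d' (int r) * ((-1) ^ (r + 1) * fact r))"
    by (rule exE[OF is_expansion_truncate[OF d']])
  \<comment> \<open>The bound by \<open>nat \<bar>t\<bar>\<close> ensures that the place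
    \<open>t\<close> lies in the compared range.\<close>
  define M where "M = max (nat \<bar>t\<bar>) (max M1 M2)"
  let ?un = "\<lambda>s. d (- int s) - d' (- int s)" and ?up = "\<lambda>r. d (int r) - d' (int r)"
  have bn: "\<bar>?un s\<bar> \<le> int s" and bp: "\<bar>?up s\<bar> \<le> int s" if "s \<ge> 1" for s
  proof -
    have "0 \<le> d (- int s)" "d (- int s) \<le> int s" "0 \<le> d' (- int s)" "d' (- int s) \<le> int s"
      "0 \<le> d (int s)" "d (int s) \<le> int s" "0 \<le> d' (int s)" "d' (int s) \<le> int s"
      using d d' that unfolding is_expansion_def by blast+
    then show "\<bar>?un s\<bar> \<le> int s" "\<bar>?up s\<bar> \<le> int s" by linarith+
  qed
  have diff: "(\<Sum>s=1..M. of_int (?un s) * ((-1) ^ s / fact (s + 1)) :: rat)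
    = of_int (- (\<Sum>r=1..M. ?up r * ((-1) ^ (r + 1) * fact r)))"
  proof -
    have "M \<ge> M1" "M \<ge> M2" by (auto simp: M_def)
    from trans[OF M1[rule_format, OF this(1), symmetric] M2[rule_format, OF this(2)]] show ?thesis
      by (simp only: of_int_diff left_diff_distrib sum_subtractf of_int_minus)
  qed
  have "(\<Sum>s=1..M. of_int (?un s) * ((-1) ^ s / fact (s + 1)) :: rat) \<in> \<int>"
    unfolding diff by (rule Ints_of_int)
  then have n: "\<forall>s\<in>{1..M}. ?un s = 0" by (intro neg_digits_zero bn)
  then have "(\<Sum>s=1..M. of_int (?un s) * ((-1) ^ s / fact (s + 1)) :: rat) = 0"
    by (intro sum.neutral) auto
  then have "(\<Sum>r=1..M. ?up r * ((-1) ^ (r + 1) * fact r)) = 0"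
    unfolding diff by (simp only: of_int_eq_0_iff neg_equal_0_iff_equal)
  then have p: "\<forall>r\<in>{1..M}. ?up r = 0" by (intro pos_digits_zero bp)
  have "nat \<bar>t\<bar> \<le> M" by (simp add: M_def)
  consider "t = 0" | "t > 0" | "t < 0" by linarith
  then show "d t = d' t"
  proof cases
    case 1
    then show ?thesis using d d' by (simp add: is_expansion_def)
  next
    case 2
    then have "?up (nat t) = 0" using p \<open>nat \<bar>t\<bar> \<le> M\<close> by (intro bspec[OF p]) auto
    then show ?thesis using 2 by simp
  next
    case 3
    then have "?un (nat (- t)) = 0" using \<open>nat \<bar>t\<bar> \<le> M\<close> by (intro bspec[OF n]) auto
    then show ?thesis using 3 by simp
  qed
qed

lemma digit_eqI: "is_expansion q d \<Longrightarrow> digit q = d"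
  unfolding digit_def by (blast intro: is_expansion_unique the_equality)

section \<open>Sums of distinct terms of the expansion\<close>

text \<open>The sum is already an expansion with digits 0 and 1, since the digit 1 is admissible at
  every nonzero place; by uniqueness its support is the domain.\<close>

lemma rdom_neg_block:
  assumes "finite H" "0 \<notin> H"
  defines "\<beta> \<equiv> \<Sum>n\<in>H. (-1) ^ n / fact (n + 1) :: rat"
  shows "rdom_neg \<beta> = (\<lambda>n. - int n) ` H" "rdom_pos \<beta> = {}"
proof -
  define d where "d = (\<lambda>t. if t \<in> (\<lambda>n. - int n) ` H then 1 else 0 :: int)"
  have *: "is_expansion \<beta> d"
  proof -
    have H: "{s. s \<ge> 1 \<and> d (- int s) \<noteq> 0} = H" "{r. r \<ge> 1 \<and> d (int r) \<noteq> 0} = {}"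
      using assms(2) by (auto simp: d_def Suc_le_eq image_iff intro: gr0I)
    have "\<beta> = (\<Sum>n\<in>H. of_int (d (- int n)) * ((-1) ^ n / fact (n + 1)))"
      unfolding \<beta>_def by (simp add: d_def)
    moreover have "finite {t. d t \<noteq> 0}" using assms(1) by (simp add: d_def)
    moreover have "d 0 = 0" using assms(2) by (auto simp: d_def)
    moreover have "0 \<le> d t" "d t \<le> 1" for t by (auto simp: d_def)
    moreover have "d t \<le> int n" if "n \<ge> 1" for n t using that by (auto simp: d_def)
    ultimately show ?thesis unfolding is_expansion_def H by simp
  qed
  show "rdom_neg \<beta> = (\<lambda>n. - int n) ` H" "rdom_pos \<beta> = {}"
    using assms(2) unfolding rdom_neg_def rdom_pos_def rdom_def digit_eqI[OF *] d_def
    by (auto intro: gr0I)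
qed

lemma rdom_pos_block:
  assumes "finite H" "0 \<notin> H"
  defines "\<gamma> \<equiv> \<Sum>n\<in>H. (-1) ^ (n + 1) * fact n :: int"
  shows "rdom_pos (of_int \<gamma>) = int ` H" "rdom_neg (of_int \<gamma>) = {}"
proof -
  define d where "d = (\<lambda>t. if t \<in> int ` H then 1 else 0 :: int)"
  have *: "is_expansion (of_int \<gamma>) d"
  proof -
    have H: "{s. s \<ge> 1 \<and> d (int s) \<noteq> 0} = H" "{r. r \<ge> 1 \<and> d (- int r) \<noteq> 0} = {}"
      using assms(2) by (auto simp: d_def Suc_le_eq image_iff intro: gr0I)
    have "(of_int \<gamma>) = (\<Sum>n\<in>H. of_int (d (int n)) * ((-1) ^ (n + 1) * fact n))"
      unfolding \<gamma>_def by (simp add: d_def)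
    moreover have "finite {t. d t \<noteq> 0}" using assms(1) by (simp add: d_def)
    moreover have "d 0 = 0" using assms(2) by (auto simp: d_def)
    moreover have "0 \<le> d t" "d t \<le> 1" for t by (auto simp: d_def)
    moreover have "d t \<le> int n" if "n \<ge> 1" for n t using that by (auto simp: d_def)
    ultimately show ?thesis unfolding is_expansion_def H by simp
  qed
  show "rdom_pos (of_int \<gamma>) = int ` H" "rdom_neg (of_int \<gamma>) = {}"
    using assms(2) unfolding rdom_neg_def rdom_pos_def rdom_def digit_eqI[OF *] d_def
    by (auto intro: gr0I)
qed

text \<open>If the sum were an integer, the indicator of \<open>H\<close>, read as a digit sequence,
  would vanish, yet it is 1 at \<open>Max H\<close>.\<close>

lemma neg_block_not_Ints:
  assumes "finite H" "0 \<notin> H" "H \<noteq> {}"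
  shows "(\<Sum>n\<in>H. (-1) ^ n / fact (n + 1) :: rat) \<notin> \<int>"
proof
  let ?u = "\<lambda>n. if n \<in> H then 1 else 0 :: int"
  assume "(\<Sum>n\<in>H. (-1) ^ n / fact (n + 1) :: rat) \<in> \<int>"
  also have "(\<Sum>n\<in>H. (-1) ^ n / fact (n + 1) :: rat)
    = (\<Sum>n=1..Max H. of_int (?u n) * ((-1) ^ n / fact (n + 1)))"
    by (rule sum.mono_neutral_cong_left)
      (use assms in \<open>auto simp: Suc_le_eq intro: gr0I\<close>)
  finally have "\<forall>n\<in>{1..Max H}. ?u n = 0" by (intro neg_digits_zero) auto
  moreover have "Max H \<in> H" "Max H \<noteq> 0" using assms Max_in by metis+
  ultimately show False by (auto dest!: bspec[of _ _ "Max H"])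
qed

lemma pos_block_nonzero:
  assumes "finite H" "0 \<notin> H" "H \<noteq> {}"
  shows "(\<Sum>n\<in>H. (-1) ^ (n + 1) * fact n :: int) \<noteq> 0"
proof
  let ?u = "\<lambda>n. if n \<in> H then 1 else 0 :: int"
  assume "(\<Sum>n\<in>H. (-1) ^ (n + 1) * fact n :: int) = 0"
  also have "(\<Sum>n\<in>H. (-1) ^ (n + 1) * fact n :: int)
    = (\<Sum>n=1..Max H. ?u n * ((-1) ^ (n + 1) * fact n))"
    by (rule sum.mono_neutral_cong_left)
      (use assms in \<open>auto simp: Suc_le_eq intro: gr0I\<close>)
  finally have "\<forall>n\<in>{1..Max H}. ?u n = 0" by (intro pos_digits_zero) auto
  moreover have "Max H \<in> H" "Max H \<noteq> 0" using assms Max_in by metis+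
  ultimately show False by (auto dest!: bspec[of _ _ "Max H"])
qed

section \<open>An IP version of Gallai's theorem\<close>

text \<open>The colour \<open>c\<close> is a parameter because colour focusing counts the colours of
  configurations with a common base point \<open>x\<close>, whose own colour may differ from
  \<open>c\<close>.\<close>

definition ip_mono :: "'i set \<Rightarrow> ('i \<Rightarrow> nat \<Rightarrow> 'g::ab_group_add) \<Rightarrow> nat set \<Rightarrow> ('g \<Rightarrow> nat) \<Rightarrow> 'g \<Rightarrow> nat \<Rightarrow> bool" where
  "ip_mono A v I \<kappa> x c \<longleftrightarrow> (\<exists>H\<subseteq>I. H \<noteq> {} \<and> (\<forall>a\<in>A. \<kappa> (x + (\<Sum>n\<in>H. v a n)) = c))"

lemma ip_monoI:
  "\<lbrakk>H \<subseteq> I; H \<noteq> {}; \<And>a. a \<in> A \<Longrightarrow> \<kappa> (x + (\<Sum>n\<in>H. v a n)) = c\<rbrakk> \<Longrightarrow> ip_mono A v I \<kappa> x c"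
  unfolding ip_mono_def by blast

lemma ip_monoE:
  assumes "ip_mono A v I \<kappa> x c"
  obtains H where "H \<subseteq> I" "H \<noteq> {}" "\<forall>a\<in>A. \<kappa> (x + (\<Sum>n\<in>H. v a n)) = c"
  using assms unfolding ip_mono_def by (elim exE conjE) (rule that)

text \<open>The base points range over a finite set \<open>G\<close> that works for all colourings, so that the
  configurations found near any translate \<open>w\<close> involve only the finitely many points \<open>w + e\<close>.\<close>

definition ip_forces :: "'i set \<Rightarrow> ('i \<Rightarrow> nat \<Rightarrow> 'g::ab_group_add) \<Rightarrow> nat \<Rightarrow> nat set \<Rightarrow> 'g set \<Rightarrow> bool" where
  "ip_forces A v r I G \<longleftrightarrow> (\<forall>\<kappa>. (\<forall>x. \<kappa> x < r) \<longrightarrow> (\<exists>g\<in>G. \<exists>c. ip_mono A v I \<kappa> g c))"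

text \<open>All \<open>r\<close> and \<open>m\<close> are covered at once: colouring by patterns
  raises the number of colours, and a later block of indices must lie beyond the earlier
  ones.\<close>

definition ip_gallai :: "'i set \<Rightarrow> ('i \<Rightarrow> nat \<Rightarrow> 'g::ab_group_add) \<Rightarrow> bool" where
  "ip_gallai A v \<longleftrightarrow> (\<forall>r m. \<exists>G N. finite G \<and> ip_forces A v r {m..<N} G)"

lemma ip_gallaiE:
  assumes "ip_gallai A v"
  obtains G N where "finite G" "ip_forces A v r {m..<N} G"
  using assms unfolding ip_gallai_def by blast

lemma ip_forcesE:
  assumes "ip_forces A v r I G" "\<And>x. \<kappa> x < r"
  obtains g c where "g \<in> G" "ip_mono A v I \<kappa> g c"
  using assms(1)[unfolded ip_forces_def, THEN spec, of \<kappa>] assms(2) by auto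

text \<open>Subtracting \<open>w\<close> from all sequences moves a whole configuration by
  \<open>sum w H\<close>, which the base point absorbs. As \<open>H\<close> is one of finitely many
  subsets of the interval, the set of base points stays finite.\<close>

lemma ip_gallai_shift:
  fixes v :: "'i \<Rightarrow> nat \<Rightarrow> 'g::ab_group_add"
  assumes "ip_gallai A (\<lambda>a n. v a n - w n)"
  shows "ip_gallai A v"
  unfolding ip_gallai_def
proof (intro allI)
  fix r m :: nat
  obtain G N where fin: "finite G" and G: "ip_forces A (\<lambda>a n. v a n - w n) r {m..<N} G"
    by (rule ip_gallaiE[OF assms])
  define G' where "G' = (\<lambda>(g, H). g - sum w H) ` (G \<times> Pow {m..<N})"
  have "finite G'" using fin by (simp add: G'_def)
  moreover have "ip_forces A v r {m..<N} G'"
    unfolding ip_forces_def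
  proof (intro allI impI)
    fix \<kappa> :: "'g \<Rightarrow> nat" assume \<kappa>: "\<forall>x. \<kappa> x < r"
    obtain g c where g: "g \<in> G" "ip_mono A (\<lambda>a n. v a n - w n) {m..<N} \<kappa> g c"
      using ip_forcesE[OF G] \<kappa> by metis
    from g(2) obtain H where H: "H \<subseteq> {m..<N}" "H \<noteq> {}"
      "\<forall>a\<in>A. \<kappa> (g + (\<Sum>n\<in>H. v a n - w n)) = c"
      by (rule ip_monoE)
    have "ip_mono A v {m..<N} \<kappa> (g - sum w H) c"
      by (rule ip_monoI[OF H(1,2)]) (use H(3) in \<open>simp add: sum_subtractf algebra_simps\<close>)
    moreover have "g - sum w H \<in> G'" using g H by (auto simp: G'_def)
    ultimately show "\<exists>g\<in>G'. \<exists>c. ip_mono A v {m..<N} \<kappa> g c" by blast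
  qed
  ultimately show "\<exists>G N. finite G \<and> ip_forces A v r {m..<N} G" by blast
qed

text \<open>The hypothesis is applied to the product colouring, which gives \<open>x\<close> the
  pattern of \<kappa> on \<open>x + E\<close>; there are finitely many patterns, coded as natural
  numbers by \<open>h\<close>.\<close>

lemma ip_gallai_translates:
  fixes v :: "'i \<Rightarrow> nat \<Rightarrow> 'g::ab_group_add"
  assumes "ip_gallai A v" "finite E"
  shows "\<exists>G N. finite G \<and> (\<forall>\<kappa> :: 'g \<Rightarrow> nat. (\<forall>x. \<kappa> x < r) \<longrightarrow>
     (\<exists>g\<in>G. \<exists>H\<subseteq>{m..<N}. H \<noteq> {} \<and>
       (\<forall>a\<in>A. \<forall>b\<in>A. \<forall>e\<in>E. \<kappa> (g + (\<Sum>n\<in>H. v a n) + e) = \<kappa> (g + (\<Sum>n\<in>H. v b n) + e))))"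
proof -
  define P where "P = E \<rightarrow>\<^sub>E {..<r}"
  have "finite P" using assms(2) by (simp add: P_def finite_PiE)
  then obtain h :: "('g \<Rightarrow> nat) \<Rightarrow> nat" and R where h: "h ` P = {i. i < R}" "inj_on h P"
    using finite_imp_inj_to_nat_seg by metis
  obtain G N where fin: "finite G" and G: "ip_forces A v R {m..<N} G"
    by (rule ip_gallaiE[OF assms(1)])
  show ?thesis
  proof (intro exI conjI allI impI)
    show "finite G" by (rule fin)
    fix \<kappa> :: "'g \<Rightarrow> nat" assume \<kappa>: "\<forall>x. \<kappa> x < r"
    define \<phi> where "\<phi> x = restrict (\<lambda>e. \<kappa> (x + e)) E" for x
    have \<phi>: "\<phi> x \<in> P" for x using \<kappa> by (auto simp: \<phi>_def P_def)
    then have "h (\<phi> x) < R" for x using h(1) by blast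
    then obtain g c where g: "g \<in> G" "ip_mono A v {m..<N} (\<lambda>x. h (\<phi> x)) g c"
      by (rule ip_forcesE[OF G])
    from g(2) obtain H where H: "H \<subseteq> {m..<N}" "H \<noteq> {}"
      "\<forall>a\<in>A. h (\<phi> (g + (\<Sum>n\<in>H. v a n))) = c"
      by (rule ip_monoE)
    have "\<kappa> (g + (\<Sum>n\<in>H. v a n) + e) = \<kappa> (g + (\<Sum>n\<in>H. v b n) + e)"
      if "a \<in> A" "b \<in> A" "e \<in> E" for a b e
    proof -
      have "\<phi> (g + (\<Sum>n\<in>H. v a n)) = \<phi> (g + (\<Sum>n\<in>H. v b n))"
        using H(3) that \<phi> by (intro inj_onD[OF h(2)]) auto
      from fun_cong[OF this, of e] that show ?thesis by (simp add: \<phi>_def)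
    qed
    then show "\<exists>g\<in>G. \<exists>H\<subseteq>{m..<N}. H \<noteq> {} \<and>
       (\<forall>a\<in>A. \<forall>b\<in>A. \<forall>e\<in>E. \<kappa> (g + (\<Sum>n\<in>H. v a n) + e) = \<kappa> (g + (\<Sum>n\<in>H. v b n) + e))"
      using g(1) H(1,2) by (intro bexI[of _ g] exI[of _ H] conjI ballI)
  qed
qed

text \<open>The alternatives of the colour focusing argument: the focus \<open>x\<close> completes a configuration, or it
  adds a new colour. The second cannot persist once \<open>j\<close> is the number of all colours.\<close>

definition ip_focused :: "'i set \<Rightarrow> ('i \<Rightarrow> nat \<Rightarrow> 'g::ab_group_add) \<Rightarrow> nat set \<Rightarrow> nat \<Rightarrow> ('g \<Rightarrow> nat) \<Rightarrow> 'g \<Rightarrow> bool" where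
  "ip_focused A v I j \<kappa> x \<longleftrightarrow> ip_mono A v I \<kappa> x (\<kappa> x) \<or>
     (\<exists>D. finite D \<and> card D = j \<and> \<kappa> x \<notin> D \<and> (\<forall>c\<in>D. ip_mono A v I \<kappa> x c))"

text \<open>Induction on \<open>j\<close>: a block \<open>K\<close> beyond all earlier indices is
  found on which changing the letter preserves the colours of all relevant points. Moving the focus
  back across \<open>K\<close> prolongs the old configurations by \<open>K\<close>, and
  \<open>K\<close> alone yields one more, in the colour of the old focus.\<close>

lemma ip_gallai_focus:
  fixes v :: "'i \<Rightarrow> nat \<Rightarrow> 'g::ab_group_add"
  assumes A: "ip_gallai A v" "finite A" "A \<noteq> {}"
  shows "\<exists>G N. finite G \<and> (\<forall>\<kappa>. (\<forall>x. \<kappa> x < r) \<longrightarrow> (\<exists>x\<in>G. ip_focused A v {m..<N} j \<kappa> x))"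
proof (induction j)
  case 0
  have "ip_focused A v {m..<0} 0 \<kappa> 0" for \<kappa> :: "'g \<Rightarrow> nat"
    unfolding ip_focused_def by (intro disjI2 exI[of _ "{}"]) simp
  then show ?case
    by (intro exI[of _ "{0}"] exI[of _ 0]) simp
next
  case (Suc j)
  obtain a0 where a0: "a0 \<in> A" using A by blast
  obtain G N where fin: "finite G" and
    G: "\<forall>\<kappa>. (\<forall>x. \<kappa> x < r) \<longrightarrow> (\<exists>x\<in>G. ip_focused A v {m..<N} j \<kappa> x)"
    using Suc.IH by (elim exE conjE) (rule that)
  \<comment> \<open>All possible foci and all points of their configurations: the offsets at which
    the colour must not depend on the letter used on \<open>K\<close>.\<close>
  define E where "E = G \<union> (\<lambda>(g, a, H). g + (\<Sum>n\<in>H. v a n)) ` (G \<times> A \<times> Pow {m..<N})"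
  have "finite E" using fin A(2) by (simp add: E_def)
  \<comment> \<open>Starting at \<open>max m N\<close> keeps \<open>K\<close> disjoint from every
    \<open>H\<close> inside \<open>{m..<N}\<close>.\<close>
  from ip_gallai_translates[OF A(1) this, of r "max m N"]
  obtain G' N' where fin': "finite G'" and
    G': "\<forall>\<kappa> :: 'g \<Rightarrow> nat. (\<forall>x. \<kappa> x < r) \<longrightarrow> (\<exists>g\<in>G'. \<exists>H\<subseteq>{max m N..<N'}. H \<noteq> {} \<and>
     (\<forall>a\<in>A. \<forall>b\<in>A. \<forall>e\<in>E. \<kappa> (g + (\<Sum>n\<in>H. v a n) + e) = \<kappa> (g + (\<Sum>n\<in>H. v b n) + e)))"
    by (elim exE conjE) (rule that)
  \<comment> \<open>The points \<open>z + x\<close> serve as new foci; the other kind,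
    \<open>w + x\<close>, serves when the configuration near \<open>w\<close> is already completed
    by its focus.\<close>
  define G'' where "G'' = (\<lambda>(x, y). x + y) ` (G' \<times> G) \<union>
    (\<lambda>(x, H, y). x + (\<Sum>n\<in>H. v a0 n) + y) ` (G' \<times> Pow {max m N..<N'} \<times> G)"
  let ?I = "{m..<max N N'}"
  show ?case
  proof (intro exI conjI allI impI)
    show "finite G''" using fin fin' by (simp add: G''_def)
    fix \<kappa> :: "'g \<Rightarrow> nat" assume \<kappa>: "\<forall>x. \<kappa> x < r"
    obtain z K where z: "z \<in> G'" and K: "K \<subseteq> {max m N..<N'}" "K \<noteq> {}" and
      zK: "\<forall>a\<in>A. \<forall>b\<in>A. \<forall>e\<in>E. \<kappa> (z + (\<Sum>n\<in>K. v a n) + e) = \<kappa> (z + (\<Sum>n\<in>K. v b n) + e)"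
      using mp[OF spec[OF G'] \<kappa>] by (elim bexE exE conjE) (rule that)
    define w where "w = z + (\<Sum>n\<in>K. v a0 n)"
    have "{m..<N} \<subseteq> ?I" "{max m N..<N'} \<subseteq> ?I" by auto
    note sub = subset_trans[OF _ this(1)] and Ksub = subset_trans[OF K(1) this(2)]
    have "\<forall>y. \<kappa> (w + y) < r" using \<kappa> by blast
    from mp[OF spec[OF G] this]
    obtain x where x: "x \<in> G" and focused: "ip_focused A v {m..<N} j (\<lambda>y. \<kappa> (w + y)) x"
      by (elim bexE) (rule that)
    from focused[unfolded ip_focused_def] show "\<exists>x\<in>G''. ip_focused A v ?I (Suc j) \<kappa> x"
    proof (elim disjE exE conjE)
      assume "ip_mono A v {m..<N} (\<lambda>y. \<kappa> (w + y)) x (\<kappa> (w + x))"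
      then obtain H where H: "H \<subseteq> {m..<N}" "H \<noteq> {}"
        "\<forall>a\<in>A. \<kappa> (w + (x + (\<Sum>n\<in>H. v a n))) = \<kappa> (w + x)" by (rule ip_monoE)
      have "ip_mono A v ?I \<kappa> (w + x) (\<kappa> (w + x))"
        by (rule ip_monoI[OF sub[OF H(1)] H(2)]) (use H(3) in \<open>simp add: add.assoc\<close>)
      moreover have "w + x \<in> G''" unfolding G''_def w_def using z K x by force
      ultimately show ?thesis unfolding ip_focused_def by blast
    next
      fix D
      assume D: "finite D" "card D = j" "\<kappa> (w + x) \<notin> D"
        "\<forall>c\<in>D. ip_mono A v {m..<N} (\<lambda>y. \<kappa> (w + y)) x c"
      let ?D = "insert (\<kappa> (w + x)) D"
      have foc: "ip_mono A v ?I \<kappa> (z + x) c" if "c \<in> ?D" for c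
      proof (cases "c \<in> D")
        case True
        then have "ip_mono A v {m..<N} (\<lambda>y. \<kappa> (w + y)) x c" using D(4) by blast
        then obtain H where H: "H \<subseteq> {m..<N}" "H \<noteq> {}"
          "\<forall>a\<in>A. \<kappa> (w + (x + (\<Sum>n\<in>H. v a n))) = c" by (rule ip_monoE)
        have KH: "K \<inter> H = {}" "finite K" "finite H"
          using H(1) K(1) by (fastforce, auto intro: finite_subset)
        show ?thesis
        proof (rule ip_monoI[of "K \<union> H"])
          show "K \<union> H \<subseteq> ?I" using sub[OF H(1)] Ksub by simp
          show "K \<union> H \<noteq> {}" using H(2) by simp
          fix a assume a: "a \<in> A"
          have eq: "z + x + (\<Sum>n\<in>K \<union> H. v a n)
            = z + (\<Sum>n\<in>K. v a n) + (x + (\<Sum>n\<in>H. v a n))"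
            using KH by (simp add: sum.union_disjoint algebra_simps)
          \<comment> \<open>The letter \<open>a\<close> acts on both \<open>K\<close> and
            \<open>H\<close>; invariance at this offset replaces it by \<open>a0\<close> on
            \<open>K\<close> only, which brings the point back to the configuration around
            \<open>w\<close>.\<close>
          have "x + (\<Sum>n\<in>H. v a n) \<in> E" using x a H(1) by (force simp: E_def)
          from zK[rule_format, OF a a0 this] show "\<kappa> (z + x + (\<Sum>n\<in>K \<union> H. v a n)) = c"
            using bspec[OF H(3) a] by (simp only: eq w_def)
        qed
      next
        case False
        then have c: "c = \<kappa> (w + x)" using that by simp
        have xE: "x \<in> E" using x by (simp add: E_def)
        show ?thesis
          by (rule ip_monoI[OF Ksub K(2)])
            (use zK[rule_format, OF _ a0 xE] in \<open>simp add: c w_def algebra_simps\<close>)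
      qed
      have "z + x \<in> G''" using z x by (force simp: G''_def)
      moreover have "ip_focused A v ?I (Suc j) \<kappa> (z + x)"
      proof (cases "\<kappa> (z + x) \<in> ?D")
        case True
        then show ?thesis unfolding ip_focused_def using foc by blast
      next
        case False
        have "finite ?D" "card ?D = Suc j" using D by simp_all
        then show ?thesis unfolding ip_focused_def using False foc by blast
      qed
      ultimately show ?thesis by blast
    qed
  qed
qed

text \<open>With \<open>j = r\<close> the second alternative would give \<open>r + 1\<close> colours
  below \<open>r\<close>. So the focus has the colour of its configuration, and it is the point that
  the zero sequence \<open>b\<close> contributes.\<close>

lemma ip_gallai_insert_zero:
  fixes v :: "'i \<Rightarrow> nat \<Rightarrow> 'g::ab_group_add"
  assumes A: "ip_gallai A v" "finite A" "A \<noteq> {}" and b: "\<And>n. v b n = 0"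
  shows "ip_gallai (insert b A) v"
  unfolding ip_gallai_def
proof (intro allI)
  fix r m :: nat
  from ip_gallai_focus[OF A, of r m r] obtain G N where fin: "finite G" and
    G: "\<forall>\<kappa>. (\<forall>x. \<kappa> x < r) \<longrightarrow> (\<exists>x\<in>G. ip_focused A v {m..<N} r \<kappa> x)"
    by (elim exE conjE) (rule that)
  have "ip_forces (insert b A) v r {m..<N} G"
    unfolding ip_forces_def
  proof (intro allI impI)
    fix \<kappa> :: "'g \<Rightarrow> nat" assume \<kappa>: "\<forall>x. \<kappa> x < r"
    obtain x where x: "x \<in> G" "ip_focused A v {m..<N} r \<kappa> x"
      using mp[OF spec[OF G] \<kappa>] by (elim bexE) (rule that)
    have False if D: "finite D" "card D = r" "\<kappa> x \<notin> D" "\<forall>c\<in>D. ip_mono A v {m..<N} \<kappa> x c" for D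
    proof -
      have "c < r" if "c \<in> D" for c
      proof -
        from D(4) that have "ip_mono A v {m..<N} \<kappa> x c" by blast
        then show ?thesis using A(3) \<kappa> by (auto elim!: ip_monoE)
      qed
      then have "insert (\<kappa> x) D \<subseteq> {..<r}" using \<kappa> by auto
      then have "card (insert (\<kappa> x) D) \<le> card {..<r}" by (intro card_mono) auto
      then show False using D by simp
    qed
    then have "ip_mono A v {m..<N} \<kappa> x (\<kappa> x)" using x(2) unfolding ip_focused_def by blast
    then obtain H where H: "H \<subseteq> {m..<N}" "H \<noteq> {}"
      "\<forall>a\<in>A. \<kappa> (x + (\<Sum>n\<in>H. v a n)) = \<kappa> x" by (rule ip_monoE)
    have "ip_mono (insert b A) v {m..<N} \<kappa> x (\<kappa> x)"
      by (rule ip_monoI[OF H(1,2)]) (use H(3) b in auto)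
    then show "\<exists>g\<in>G. \<exists>c. ip_mono (insert b A) v {m..<N} \<kappa> g c" using x(1) by blast
  qed
  with fin show "\<exists>G N. finite G \<and> ip_forces (insert b A) v r {m..<N} G" by blast
qed

text \<open>Subtracting \<open>v b\<close> from all sequences makes the new one zero; the induction
  hypothesis, available for every \<open>v\<close>, is applied to the differences.\<close>

lemma ip_gallai:
  fixes v :: "'i \<Rightarrow> nat \<Rightarrow> 'g::ab_group_add"
  assumes "finite A" "A \<noteq> {}"
  shows "ip_gallai A v"
  using assms
proof (induction A arbitrary: v rule: finite_ne_induct)
  case (singleton a)
  have "ip_forces {a} v r {m..<Suc m} {0}" for r m
    unfolding ip_forces_def
  proof (intro allI impI)
    fix \<kappa> :: "'g \<Rightarrow> nat"
    have "ip_mono {a} v {m..<Suc m} \<kappa> 0 (\<kappa> (v a m))"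
      by (rule ip_monoI[of "{m}"]) auto
    then show "\<exists>g\<in>{0}. \<exists>c. ip_mono {a} v {m..<Suc m} \<kappa> g c" by blast
  qed
  then show ?case unfolding ip_gallai_def by (meson finite.intros)
next
  case (insert b A)
  have "ip_gallai (insert b A) (\<lambda>a n. v a n - v b n)"
    using insert by (intro ip_gallai_insert_zero) auto
  then show ?case by (rule ip_gallai_shift)
qed

lemma ip_gallai_finite_colouring:
  fixes v :: "'i \<Rightarrow> nat \<Rightarrow> 'g::ab_group_add" and \<kappa> :: "'g \<Rightarrow> 'c"
  assumes "finite A" "finite (range \<kappa>)"
  obtains x H where "finite H" "H \<noteq> {}" "H \<subseteq> {m..}"
    "\<forall>a\<in>A. \<forall>b\<in>A. \<kappa> (x + (\<Sum>n\<in>H. v a n)) = \<kappa> (x + (\<Sum>n\<in>H. v b n))"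
proof (cases "A = {}")
  case True
  then show thesis by (intro that[of "{m}"]) auto
next
  case False
  obtain h :: "'c \<Rightarrow> nat" and r where h: "h ` range \<kappa> = {i. i < r}" "inj_on h (range \<kappa>)"
    using finite_imp_inj_to_nat_seg[OF assms(2)] by metis
  then have bound: "h (\<kappa> x) < r" for x by blast
  obtain G N where "ip_forces A v r {m..<N} G"
    by (rule ip_gallaiE[OF ip_gallai[OF assms(1) False]])
  then obtain x c where "ip_mono A v {m..<N} (\<lambda>x. h (\<kappa> x)) x c"
    using bound by (rule ip_forcesE)
  then obtain H where H: "H \<subseteq> {m..<N}" "H \<noteq> {}"
    "\<forall>a\<in>A. h (\<kappa> (x + (\<Sum>n\<in>H. v a n))) = c"
    by (rule ip_monoE)
  show thesis
  proof (rule that)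
    show "finite H" "H \<noteq> {}" "H \<subseteq> {m..}"
      using H by (auto intro: finite_subset)
    show "\<forall>a\<in>A. \<forall>b\<in>A. \<kappa> (x + (\<Sum>n\<in>H. v a n)) = \<kappa> (x + (\<Sum>n\<in>H. v b n))"
      using H(3) by (intro ballI inj_onD[OF h(2)]) auto
  qed
qed

section \<open>Colourings from compact metric spaces\<close>

lemma sum_fun_apply: "(\<Sum>n\<in>H. u n) i = (\<Sum>n\<in>H. u n i)"
  for u :: "'b \<Rightarrow> 'c \<Rightarrow> 'd::comm_monoid_add"
  by (induction H rule: infinite_finite_induct) simp_all

text \<open>By total boundedness finitely many balls of radius \<open>\<delta> / 2\<close> cover the
  space; a point is coloured by the centre of one that contains it.\<close>

lemma compact_metric_colouring:
  fixes X :: "'a metric"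
  assumes "compact_space (mtopology_of X)" "\<delta> > 0"
  shows "\<exists>c :: 'a \<Rightarrow> 'a. finite (range c) \<and>
    (\<forall>x\<in>mspace X. \<forall>y\<in>mspace X. c x = c y \<longrightarrow> mdist X x y < \<delta>)"
proof -
  interpret Metric_space "mspace X" "mdist X" by simp
  have "mtotally_bounded (mspace X)"
    using assms(1) compact_space_eq_mcomplete_mtotally_bounded by (simp add: mtopology_of_def)
  moreover have "\<delta> / 2 > 0" using assms(2) by simp
  ultimately obtain K where K: "finite K" "mspace X \<subseteq> (\<Union>y\<in>K. mball y (\<delta> / 2))"
    unfolding mtotally_bounded_def by meson
  then have "\<forall>x\<in>mspace X. \<exists>y. y \<in> K \<and> x \<in> mball y (\<delta> / 2)" by blast
  then obtain c where c: "\<And>x. x \<in> mspace X \<Longrightarrow> c x \<in> K \<and> x \<in> mball (c x) (\<delta> / 2)" by metis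
  \<comment> \<open>Outside the space \<open>c\<close> is arbitrary, so a constant value is needed
    there for a finite range.\<close>
  define c' where "c' x = (if x \<in> mspace X then c x else undefined)" for x
  have "range c' \<subseteq> insert undefined K" using c by (auto simp: c'_def)
  then have "finite (range c')" using K(1) by (meson finite.insertI finite_subset)
  moreover have "mdist X x y < \<delta>" if "x \<in> mspace X" "y \<in> mspace X" "c' x = c' y" for x y
  proof -
    have "mdist X (c x) x < \<delta> / 2" "mdist X (c x) y < \<delta> / 2" "c x \<in> mspace X"
      using c[OF that(1)] c[OF that(2)] that(3) by (simp_all only: c'_def in_mball that(1,2) if_True)
    then show ?thesis using triangle[of x "c x" y] that commute[of x "c x"] by simp
  qed
  ultimately show ?thesis by blast
qed

lemma mdiam_le:
  assumes "A \<noteq> {}" "\<And>x y. \<lbrakk>x \<in> A; y \<in> A\<rbrakk> \<Longrightarrow> mdist X x y \<le> \<delta>"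
  shows "mdiam X A \<le> \<delta>"
  unfolding mdiam_def
proof (rule cSup_least)
  show "{mdist X x y |x y. x \<in> A \<and> y \<in> A} \<noteq> {}" using assms(1) by blast
qed (use assms(2) in auto)

text \<open>The colouring must be defined on the whole group of functions, whereas
  \<open>f i\<close> is controlled only on \<open>rat_space (l i)\<close>; projecting the argument
  bridges the gap.\<close>

definition rat_proj :: "nat \<Rightarrow> (nat \<Rightarrow> rat) \<Rightarrow> nat \<Rightarrow> rat" where
  "rat_proj l x = (\<lambda>j. if j \<in> {1..l} then x j else 0)"

lemma rat_proj_in_rat_space: "rat_proj l x \<in> rat_space l"
  by (simp add: rat_proj_def rat_space_def)

lemma rat_proj_add_scale:
  "u \<in> rat_space l \<Longrightarrow> rat_proj l (\<lambda>j. x j + c * u j) = (\<lambda>j. rat_proj l x j + c * u j)"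
  by (auto simp: rat_proj_def rat_space_def)

section \<open>Derivation of the theorem\<close>

theorem theorem5p2:
  fixes s :: nat and l :: "nat \<Rightarrow> nat" and k1 k2 :: real
    and X :: "nat \<Rightarrow> 'a metric" and f :: "nat \<Rightarrow> (nat \<Rightarrow> rat) \<Rightarrow> 'a"
    and \<epsilon> :: real and k :: nat and F :: "nat \<Rightarrow> (nat \<Rightarrow> rat) set"
  assumes "s \<ge> 1"
    and "\<And>i. i \<in> {1..s} \<Longrightarrow> l i \<ge> 1"
    and "k1 < k2"
    and "\<And>i. i \<in> {1..s} \<Longrightarrow> compact_space (mtopology_of (X i))"
    and "\<And>i. i \<in> {1..s} \<Longrightarrow> f i \<in> rat_space (l i) \<rightarrow> mspace (X i)"
    and "\<epsilon> > 0"
    and "k \<ge> 1"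
    and "\<And>i. i \<in> {1..s} \<Longrightarrow> finite (F i) \<and> F i \<noteq> {} \<and> F i \<subseteq> rat_space (l i)"
  shows "\<exists>(\<alpha> :: nat \<Rightarrow> nat \<Rightarrow> rat) (\<beta> :: rat) (\<gamma> :: int).
      (\<forall>i\<in>{1..s}. \<alpha> i \<in> rat_space (l i)) \<and>
      \<beta> \<notin> \<int> \<and> \<gamma> \<noteq> 0 \<and>
      rdom_pos \<beta> = {} \<and> rdom_neg (of_int \<gamma>) = {} \<and>
      real_of_int (Max (rdom_neg \<beta>)) < k1 \<and> k1 < k2 \<and>
      k2 < real_of_int (Min (rdom_pos (of_int \<gamma>))) \<and>
      (\<forall>p q :: nat. p \<le> k \<longrightarrow> q \<le> k \<longrightarrow>
        (\<forall>i\<in>{1..s}.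
          mdiam (X i) (f i ` translate_scale (\<alpha> i) (of_nat p * \<beta> + of_nat q * of_int \<gamma>) (F i)) < \<epsilon>))"
proof -
  \<comment> \<open>For \<open>n \<ge> m\<close> both \<open>- n < k1\<close> and
    \<open>k2 < n\<close> hold; moreover \<open>m\<close> is positive, which keeps 0 out of
    \<open>H\<close>.\<close>
  obtain m where m: "max \<bar>k1\<bar> \<bar>k2\<bar> < real m" using reals_Archimedean2 by blast
  have "\<forall>i\<in>{1..s}. \<exists>c :: 'a \<Rightarrow> 'a. finite (range c) \<and>
    (\<forall>x\<in>mspace (X i). \<forall>y\<in>mspace (X i). c x = c y \<longrightarrow> mdist (X i) x y < \<epsilon> / 2)"
    using assms(4,6) by (intro ballI compact_metric_colouring) auto
  then obtain c :: "nat \<Rightarrow> 'a \<Rightarrow> 'a" where c: "\<forall>i\<in>{1..s}. finite (range (c i)) \<and>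
    (\<forall>x\<in>mspace (X i). \<forall>y\<in>mspace (X i). c i x = c i y \<longrightarrow> mdist (X i) x y < \<epsilon> / 2)"
    by (rule bchoice[THEN exE])
  \<comment> \<open>One colouring records all \<open>i\<close> together, so that a single
    \<open>H\<close>, and hence a single \<beta> and \<gamma>, serves every
    \<open>f i\<close>.\<close>
  define \<kappa> where "\<kappa> x = (\<lambda>i\<in>{1..s}. c i (f i (rat_proj (l i) (x i))))" for x :: "nat \<Rightarrow> nat \<Rightarrow> rat"
  define A where "A = {..k} \<times> {..k} \<times> Pi\<^sub>E {1..s} F"
  define b g :: "nat \<Rightarrow> rat"
    where "b n = (-1) ^ n / fact (n + 1)" and "g n = of_int ((-1) ^ (n + 1) * fact n)" for n
  \<comment> \<open>For \<open>i\<close> outside \<open>{1..s}\<close> the value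
    \<open>\<phi> i\<close> is \<open>undefined\<close>, which is harmless because \<kappa> reads
    only the components in \<open>{1..s}\<close>.\<close>
  define v where "v = (\<lambda>(p :: nat, q :: nat, \<phi> :: nat \<Rightarrow> nat \<Rightarrow> rat) n i j. (of_nat p * b n + of_nat q * g n) * \<phi> i j)"
  have "finite A" unfolding A_def using assms(8) by (intro finite_cartesian_product finite_PiE) auto
  moreover have "finite (range \<kappa>)"
  proof (rule finite_subset)
    show "range \<kappa> \<subseteq> Pi\<^sub>E {1..s} (\<lambda>i. range (c i))" by (auto simp: \<kappa>_def)
    show "finite (Pi\<^sub>E {1..s} (\<lambda>i. range (c i)))" using c by (intro finite_PiE) auto
  qed
  ultimately obtain x H where H: "finite H" "H \<noteq> {}" "H \<subseteq> {m..}" and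
    mono: "\<forall>a\<in>A. \<forall>a'\<in>A. \<kappa> (x + (\<Sum>n\<in>H. v a n)) = \<kappa> (x + (\<Sum>n\<in>H. v a' n))"
    by (rule ip_gallai_finite_colouring[of A \<kappa> m v])
  have "0 \<notin> H" using H(3) m by auto
  define \<alpha> where "\<alpha> i = rat_proj (l i) (x i)" for i
  define \<beta> where "\<beta> = (\<Sum>n\<in>H. (-1) ^ n / fact (n + 1) :: rat)"
  define \<gamma> where "\<gamma> = (\<Sum>n\<in>H. (-1) ^ (n + 1) * fact n :: int)"
  have rdom_\<beta>: "rdom_neg \<beta> = (\<lambda>n. - int n) ` H" "rdom_pos \<beta> = {}"
    unfolding \<beta>_def by (rule rdom_neg_block[OF H(1) \<open>0 \<notin> H\<close>])+
  have rdom_\<gamma>: "rdom_pos (of_int \<gamma>) = int ` H" "rdom_neg (of_int \<gamma>) = {}"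
    unfolding \<gamma>_def by (rule rdom_pos_block[OF H(1) \<open>0 \<notin> H\<close>])+
  have small: "mdiam (X i) (f i ` translate_scale (\<alpha> i) (of_nat p * \<beta> + of_nat q * of_int \<gamma>) (F i)) < \<epsilon>"
    if pq: "p \<le> k" "q \<le> k" and i: "i \<in> {1..s}" for p q i
  proof -
    define r where "r = of_nat p * \<beta> + of_nat q * of_int \<gamma>"
    have F: "finite (F i)" "F i \<noteq> {}" "F i \<subseteq> rat_space (l i)" using assms(8)[OF i] by auto
    have "Pi\<^sub>E {1..s} F \<noteq> {}" using assms(8) by (simp add: PiE_eq_empty_iff)
    \<comment> \<open>An arbitrary choice function; changing it at \<open>i\<close> alone yields
      letters that reach any two points of \<open>F i\<close> with the same \<open>p\<close> and
      \<open>q\<close>.\<close>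
    then obtain \<phi> where \<phi>: "\<phi> \<in> Pi\<^sub>E {1..s} F" by blast
    have point: "(p, q, \<phi>(i := u)) \<in> A"
      "rat_proj (l i) ((x + (\<Sum>n\<in>H. v (p, q, \<phi>(i := u)) n)) i) = (\<lambda>j. \<alpha> i j + r * u j)"
      if u: "u \<in> F i" for u
    proof -
      show "(p, q, \<phi>(i := u)) \<in> A" using \<phi> u pq i by (auto simp: A_def PiE_iff extensional_def)
      have r: "r = (\<Sum>n\<in>H. of_nat p * b n + of_nat q * g n)"
        unfolding r_def \<beta>_def \<gamma>_def b_def g_def of_int_sum
        by (simp only: sum.distrib sum_distrib_left)
      have "(x + (\<Sum>n\<in>H. v (p, q, \<phi>(i := u)) n)) i = (\<lambda>j. x i j + r * u j)"
        by (simp add: fun_eq_iff sum_fun_apply v_def r sum_distrib_right)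
      then show "rat_proj (l i) ((x + (\<Sum>n\<in>H. v (p, q, \<phi>(i := u)) n)) i) = (\<lambda>j. \<alpha> i j + r * u j)"
        using F(3) u by (simp only: rat_proj_add_scale \<alpha>_def subset_iff)
    qed
    have "mdist (X i) (f i (\<lambda>j. \<alpha> i j + r * u j)) (f i (\<lambda>j. \<alpha> i j + r * u' j)) \<le> \<epsilon> / 2"
      if "u \<in> F i" "u' \<in> F i" for u u'
    proof -
      have "c i (f i (\<lambda>j. \<alpha> i j + r * u j)) = c i (f i (\<lambda>j. \<alpha> i j + r * u' j))"
        using fun_cong[OF mono[rule_format, OF point(1)[OF that(1)] point(1)[OF that(2)]], of i] i
        by (simp only: \<kappa>_def point(2) that restrict_apply if_True)
      moreover have "f i (\<lambda>j. \<alpha> i j + r * u j) \<in> mspace (X i)" if "u \<in> F i" for u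
        using assms(5)[OF i] rat_proj_in_rat_space point(2)[OF that] by (metis PiE Pi_iff)
      ultimately show ?thesis using c i that by (meson less_imp_le)
    qed
    \<comment> \<open>The supremum preserves only a weak bound; the colouring at scale
      \<open>\<epsilon> / 2\<close> leaves room for the strict inequality.\<close>
    then have "mdiam (X i) (f i ` translate_scale (\<alpha> i) r (F i)) \<le> \<epsilon> / 2"
      using F(2) by (intro mdiam_le) (auto simp: translate_scale_def)
    then show ?thesis using assms(6) by (simp add: r_def)
  qed
  have "real_of_int (Max (rdom_neg \<beta>)) < k1"
  proof -
    have "Max (rdom_neg \<beta>) \<in> (\<lambda>n. - int n) ` H" unfolding rdom_\<beta> using H(1,2) by (intro Max_in) auto
    then obtain n where "n \<in> H" "Max (rdom_neg \<beta>) = - int n" by blast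
    moreover have "real m \<le> real n" using H(3) \<open>n \<in> H\<close> by auto
    ultimately have "real_of_int (Max (rdom_neg \<beta>)) = - real n" "real m \<le> real n" by simp_all
    then show ?thesis using m by linarith
  qed
  moreover have "k2 < real_of_int (Min (rdom_pos (of_int \<gamma>)))"
  proof -
    have "Min (rdom_pos (of_int \<gamma>)) \<in> int ` H" unfolding rdom_\<gamma> using H(1,2) by (intro Min_in) auto
    then obtain n where "n \<in> H" "Min (rdom_pos (of_int \<gamma>)) = int n" by blast
    moreover have "real m \<le> real n" using H(3) \<open>n \<in> H\<close> by auto
    ultimately have "real_of_int (Min (rdom_pos (of_int \<gamma>))) = real n" "real m \<le> real n" by simp_all
    then show ?thesis using m by linarith
  qed
  moreover have "\<beta> \<notin> \<int>" unfolding \<beta>_def by (rule neg_block_not_Ints[OF H(1) \<open>0 \<notin> H\<close> H(2)])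
  moreover have "\<gamma> \<noteq> 0" unfolding \<gamma>_def by (rule pos_block_nonzero[OF H(1) \<open>0 \<notin> H\<close> H(2)])
  moreover have "\<forall>i\<in>{1..s}. \<alpha> i \<in> rat_space (l i)" by (simp add: \<alpha>_def rat_proj_in_rat_space)
  ultimately show ?thesis using rdom_\<beta>(2) rdom_\<gamma>(2) assms(3) small
    by (intro exI[of _ \<alpha>] exI[of _ \<beta>] exI[of _ \<gamma>] conjI allI impI ballI) auto
qed

end
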